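(* For any $\delta\in[0,0.5]$, there exists a randomized mechanism on the line that is truthful in expectation, $(1+\delta)$-consistent, and $(2-\delta)$-robust.
   Context: Single facility location on the line with strategic agents. There are $n$ agents with location profile $\mathbf{x}=\langle x_1,\dots,x_n\rangle$, $x_i\in\mathbb{R}$, where $x_i$ is the private preferred location of agent $i$; $d(a,b)=|a-b|$. A mechanism $f$ takes the reported locations and outputs a, potentially randomized, facility location in $\mathbb{R}$. The cost incurred by agent $i$ is the expected distance between $x_i$ and the facility. The egalitarian social cost is $C(f,\mathbf{x})=\mathbb{E}[\max_{i} d(x_i,f(\mathbf{x}))]$. The optimal location $o(\mathbf{x})$ is the midpoint of the leftmost and rightmost locations in $\mathbf{x}$, with optimal cost $C(o(\mathbf{x}),\mathbf{x})$. Predictions. A learning-augmented mechanism, written $f(\mathbf{x},* )$, additionally receives a prediction $*$ about the instance, which may be inaccurate. Various types of prediction can be considered, for instance predictions $\hat{\mathbf{x}}$ of all agents' preferred locations, a prediction $F^*$ of the optimal facility location, or a prediction of the identities of the agents that suffer the maximum cost in the optimal solution. The claim does not specify the type of prediction used. Write $\mathbf{x}\vartriangleleft *$ if the prediction $*$ is accurate for the instance $\mathbf{x}$. Consistency and robustness. The mechanism is $\alpha$-consistent if $\max_{\mathbf{x},*:\,\mathbf{x}\vartriangleleft *}\left\{\frac{C(f(\mathbf{x},* ),\mathbf{x})}{C(o(\mathbf{x}),\mathbf{x})}\right\}\le\alpha$, and $\beta$-robust if $\max_{\mathbf{x},*}\left\{\frac{C(f(\mathbf{x},* ),\mathbf{x})}{C(o(\mathbf{x}),\mathbf{x})}\right\}\le\beta$,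 i.e. the latter approximation holds regardless of the quality of the prediction. Truthful in expectation: for all instances $\mathbf{x}$, every agent $i$ and every deviation $x_i'\in\mathbb{R}$, $\mathbb{E}[d(x_i,f(\mathbf{x}))]\le\mathbb{E}[d(x_i,f(\mathbf{x}_{-i},x_i'))]$, where $(\mathbf{x}_{-i},x_i')$ is $\mathbf{x}$ with $x_i$ replaced by $x_i'$; for a mechanism with predictions, this is required with the prediction, whatever it is, held fixed. Standing assumptions on mechanisms: unanimous (if all agents are located at the same position, the facility is placed at that position); anonymous (the outcome is independent of the agents' identities, remaining unchanged under any permutation of the agents); scale-independent (if every coordinate of every agent is multiplied by the same factor, the coordinates of the chosen facility location are scaled in the same way). *)

theory Defs
  imports "HOL-Probability.Probability"
begin

text \<open>
  The agents are the elements of an arbitrary finite type \<open>'a\<close>, so their number is \<open>CARD('a) \<ge> 1\<close>.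
  A mechanism maps the reported locations and a prediction (of type \<open>'p\<close>) to the distribution of
  the facility location.
\<close>

type_synonym 'a profile = "'a \<Rightarrow> real"

type_synonym ('a, 'p) mechanism = "'a profile \<Rightarrow> 'p \<Rightarrow> real measure"

text \<open>
  Expected costs are taken in \<open>[0, \<infinity>]\<close>, so that they make sense without integrability assumptions.
\<close>

definition agent_cost :: "real \<Rightarrow> real measure \<Rightarrow> ennreal" where
  "agent_cost a M = (\<integral>\<^sup>+ y. ennreal (dist a y) \<partial>M)"

definition social_cost :: "real measure \<Rightarrow> 'a::finite profile \<Rightarrow> ennreal" where
  "social_cost M x = (\<integral>\<^sup>+ y. ennreal (MAX i. dist (x i) y) \<partial>M)"

definition opt_location :: "'a::finite profile \<Rightarrow> real" where
  "opt_location x = (Min (range x) + Max (range x)) / 2"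

text \<open>
  In \<^typ>\<open>ennreal\<close>, \<open>c / 0 = \<infinity>\<close> for \<open>c > 0\<close> and \<open>0 / 0 = 0\<close>: on an instance of optimal cost \<open>0\<close>, any
  bounded ratio forces the mechanism to have cost \<open>0\<close> as well.
\<close>

definition cost_ratio :: "real measure \<Rightarrow> 'a::finite profile \<Rightarrow> ennreal" where
  "cost_ratio M x = social_cost M x / social_cost (return borel (opt_location x)) x"

text \<open>
  A type of prediction says when a prediction is accurate for an instance, and how a prediction
  is transformed when the agents are relabelled and when all coordinates are multiplied by a factor.
\<close>

record ('a, 'p) prediction_kind =
  accurate :: "'a profile \<Rightarrow> 'p \<Rightarrow> bool"
  relabel :: "('a \<Rightarrow> 'a) \<Rightarrow> 'p \<Rightarrow> 'p"
  rescale :: "real \<Rightarrow> 'p \<Rightarrow> 'p"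

definition facility_prediction :: "('a::finite, real) prediction_kind" where
  "facility_prediction =
     \<lparr> accurate = (\<lambda>x F. F = opt_location x),
       relabel = (\<lambda>\<pi> F. F),
       rescale = (\<lambda>c F. c * F) \<rparr>"

definition locations_prediction :: "('a::finite, 'a profile) prediction_kind" where
  "locations_prediction =
     \<lparr> accurate = (\<lambda>x xh. xh = x),
       relabel = (\<lambda>\<pi> xh. xh \<circ> \<pi>),
       rescale = (\<lambda>c xh i. c * xh i) \<rparr>"

definition randomized_mechanism :: "('a::finite, 'p) mechanism \<Rightarrow> bool" where
  "randomized_mechanism f \<longleftrightarrow> (\<forall>x p. prob_space (f x p) \<and> sets (f x p) = sets borel)"

definition unanimous :: "('a::finite, 'p) mechanism \<Rightarrow> bool" where
  "unanimous f \<longleftrightarrow> (\<forall>x p a. (\<forall>i. x i = a) \<longrightarrow> (AE y in f x p. y = a))"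

definition anonymous :: "('a::finite, 'p) prediction_kind \<Rightarrow> ('a, 'p) mechanism \<Rightarrow> bool" where
  "anonymous K f \<longleftrightarrow> (\<forall>\<pi> x p. bij \<pi> \<longrightarrow> f (x \<circ> \<pi>) (relabel K \<pi> p) = f x p)"

definition scale_independent :: "('a::finite, 'p) prediction_kind \<Rightarrow> ('a, 'p) mechanism \<Rightarrow> bool" where
  "scale_independent K f \<longleftrightarrow>
     (\<forall>c x p. f (\<lambda>i. c * x i) (rescale K c p) = distr (f x p) borel (\<lambda>y. c * y))"

definition truthful_in_expectation :: "('a::finite, 'p) mechanism \<Rightarrow> bool" where
  "truthful_in_expectation f \<longleftrightarrow>
     (\<forall>x p i x'. agent_cost (x i) (f x p) \<le> agent_cost (x i) (f (x(i := x')) p))"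

definition consistent ::
  "('a::finite, 'p) prediction_kind \<Rightarrow> real \<Rightarrow> ('a, 'p) mechanism \<Rightarrow> bool" where
  "consistent K \<alpha> f \<longleftrightarrow>
     (SUP (x, p) \<in> {(x, p). accurate K x p}. cost_ratio (f x p) x) \<le> ennreal \<alpha>"

definition robust :: "real \<Rightarrow> ('a::finite, 'p) mechanism \<Rightarrow> bool" where
  "robust \<beta> f \<longleftrightarrow> (SUP (x, p) \<in> UNIV. cost_ratio (f x p) x) \<le> ennreal \<beta>"

end

theory Submission
  imports Defs
begin

text \<open>
  With probability \<open>2\<delta>\<close> run the prediction-free mechanism that picks the leftmost agent, the
  rightmost agent and the midpoint with probabilities \<open>1/4\<close>, \<open>1/4\<close>, \<open>1/2\<close>, which is
  \<open>3/2\<close>-approximate; otherwise project the predicted facility location onto the interval spanned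
  by the agents, which is \<open>1\<close>-consistent and \<open>2\<close>-robust. Both mechanisms are truthful in
  expectation, hence so is the mixture. A prediction of all locations is used only through its
  optimal facility location.
\<close>

definition leftmost :: "'a::finite profile \<Rightarrow> real" where
  "leftmost x = Min (range x)"

definition rightmost :: "'a::finite profile \<Rightarrow> real" where
  "rightmost x = Max (range x)"

definition clip :: "'a::finite profile \<Rightarrow> real \<Rightarrow> real" where
  "clip x F = max (leftmost x) (min F (rightmost x))"

definition mix_pmf :: "real \<Rightarrow> 'a pmf \<Rightarrow> 'a pmf \<Rightarrow> 'a pmf" where
  "mix_pmf w p q = bind_pmf (bernoulli_pmf w) (\<lambda>b. if b then p else q)"

text \<open>The weight \<open>2 * \<delta>\<close> makes the two guarantees come out as \<open>2 *
  \<delta> * (3 / 2) + (1 - 2 * \<delta>) * 1 = 1 + \<delta>\<close> for an accurate prediction and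
  \<open>2 * \<delta> * (3 / 2) + (1 - 2 * \<delta>) * 2 = 2 - \<delta>\<close> in the worst
  case.\<close>

definition lottery :: "real \<Rightarrow> 'a::finite profile \<Rightarrow> real \<Rightarrow> real pmf" where
  "lottery \<delta> x F = mix_pmf (2 * \<delta>)
     (mix_pmf (1 / 2) (mix_pmf (1 / 2) (return_pmf (leftmost x)) (return_pmf (rightmost x)))
       (return_pmf (opt_location x)))
     (return_pmf (clip x F))"

text \<open>\<open>measure_pmf\<close> carries the discrete sigma-algebra; the push-forward along
  the identity yields the Borel one that \<open>randomized_mechanism\<close> asks for.\<close>

definition mixture_mechanism :: "real \<Rightarrow> ('a::finite, real) mechanism" where
  "mixture_mechanism \<delta> x F = distr (measure_pmf (lottery \<delta> x F)) borel (\<lambda>y. y)"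

section \<open>Mixtures of probability mass functions\<close>

lemma nn_integral_mix_pmf:
  fixes p q :: "'a pmf" and g :: "'a \<Rightarrow> ennreal"
  assumes "0 \<le> w" "w \<le> 1"
    and "0 \<le> a" "(\<integral>\<^sup>+ y. g y \<partial>p) = ennreal a"
    and "0 \<le> b" "(\<integral>\<^sup>+ y. g y \<partial>q) = ennreal b"
  shows "(\<integral>\<^sup>+ y. g y \<partial>mix_pmf w p q) = ennreal (w * a + (1 - w) * b)"
  using assms by (simp add: mix_pmf_def ennreal_mult mult.commute)

lemma map_mix_pmf: "map_pmf h (mix_pmf w p q) = mix_pmf w (map_pmf h p) (map_pmf h q)"
  by (auto simp: mix_pmf_def map_bind_pmf intro: bind_pmf_cong)

text \<open>A fair coin has the same distribution as its negation.\<close>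

lemma mix_half_commute: "mix_pmf (1 / 2) p q = mix_pmf (1 / 2) q p"
proof -
  have "bernoulli_pmf (1 / 2) = map_pmf Not (bernoulli_pmf (1 / 2))"
    by (simp add: bernoulli_pmf_half_conv_pmf_of_set map_pmf_of_set_inj inj_def
        UNIV_bool insert_commute)
  then have "mix_pmf (1 / 2) p q =
      bind_pmf (map_pmf Not (bernoulli_pmf (1 / 2))) (\<lambda>b. if b then p else q)"
    by (simp add: mix_pmf_def)
  also have "\<dots> = mix_pmf (1 / 2) q p"
    by (auto simp: bind_map_pmf mix_pmf_def intro: bind_pmf_cong)
  finally show ?thesis .
qed

lemma set_mix_pmf_subset: "set_pmf (mix_pmf w p q) \<subseteq> set_pmf p \<union> set_pmf q"
  by (auto simp: mix_pmf_def split: if_splits)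

section \<open>Extreme agents and their response to a misreport\<close>

lemma opt_location_eq: "opt_location x = (leftmost x + rightmost x) / 2"
  by (simp add: opt_location_def leftmost_def rightmost_def)

lemma leftmost_le: "leftmost x \<le> x i"
  and le_rightmost: "x i \<le> rightmost x"
  by (simp_all add: leftmost_def rightmost_def)

lemma leftmost_attained: obtains i where "leftmost x = x i"
proof -
  have "leftmost x \<in> range x"
    unfolding leftmost_def by (rule Min_in) auto
  then show ?thesis
    using that by blast
qed

lemma rightmost_attained: obtains i where "rightmost x = x i"
proof -
  have "rightmost x \<in> range x"
    unfolding rightmost_def by (rule Max_in) auto
  then show ?thesis
    using that by blast
qed

lemma leftmost_le_rightmost: "leftmost x \<le> rightmost x"
  using leftmost_le[of x] le_rightmost[of x] order_trans by blast

lemma leftmost_eqI: "(\<And>i. a \<le> x i) \<Longrightarrow> x j = a \<Longrightarrow> leftmost x = a"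
  unfolding leftmost_def by (rule Min_eqI) auto

lemma rightmost_eqI: "(\<And>i. x i \<le> a) \<Longrightarrow> x j = a \<Longrightarrow> rightmost x = a"
  unfolding rightmost_def by (rule Max_eqI) auto

text \<open>Whoever attains the minimum is a different agent and keeps its report. Together with the
  mirror image \<open>rightmost_upd_ge\<close> this drives truthfulness: a misreport moves an
  extreme only away from the deviating agent.\<close>

lemma leftmost_upd_le:
  assumes "leftmost x < x i"
  shows "leftmost (x(i := a)) \<le> leftmost x"
proof -
  obtain j where "leftmost x = x j"
    by (rule leftmost_attained)
  then show ?thesis
    using assms leftmost_le[of "x(i := a)" j] by (auto split: if_splits)
qed

lemma rightmost_upd_ge:
  assumes "x i < rightmost x"
  shows "rightmost x \<le> rightmost (x(i := a))"
proof -
  obtain j where "rightmost x = x j"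
    by (rule rightmost_attained)
  then show ?thesis
    using assms le_rightmost[of "x(i := a)" j] by (auto split: if_splits)
qed

section \<open>Expected costs and approximation ratio\<close>

text \<open>Agent costs and social costs are both expectations of this kind; the closed form reduces
  their comparison to real linear inequalities.\<close>

lemma nn_integral_mixture_mechanism:
  fixes x :: "'a::finite profile" and g :: "real \<Rightarrow> real"
  assumes \<delta>: "0 \<le> \<delta>" "\<delta> \<le> 1 / 2" and g: "\<And>y. 0 \<le> g y"
    and [measurable]: "g \<in> borel_measurable borel"
  shows "(\<integral>\<^sup>+ y. ennreal (g y) \<partial>mixture_mechanism \<delta> x F) =
    ennreal (\<delta> / 2 * (g (leftmost x) + g (rightmost x) + 2 * g (opt_location x))
      + (1 - 2 * \<delta>) * g (clip x F))"
proof -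
  have "(\<integral>\<^sup>+ y. ennreal (g y) \<partial>lottery \<delta> x F) =
    ennreal (2 * \<delta> * (1 / 2 * (1 / 2 * g (leftmost x) + (1 - 1 / 2) * g (rightmost x))
      + (1 - 1 / 2) * g (opt_location x)) + (1 - 2 * \<delta>) * g (clip x F))"
    unfolding lottery_def by (intro nn_integral_mix_pmf) (use \<delta> g in auto)
  also have "2 * \<delta> * (1 / 2 * (1 / 2 * g (leftmost x) + (1 - 1 / 2) * g (rightmost x))
      + (1 - 1 / 2) * g (opt_location x)) =
    \<delta> / 2 * (g (leftmost x) + g (rightmost x) + 2 * g (opt_location x))"
    by (simp add: field_simps)
  finally show ?thesis
    by (simp add: mixture_mechanism_def nn_integral_distr)
qed

text \<open>The agent farthest from \<open>y\<close> is an extreme one across the midpoint from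
  \<open>y\<close>, and it lies half the span beyond the midpoint. So the excess over the optimal
  cost is exactly the distance to the midpoint.\<close>

lemma Max_dist_eq:
  fixes x :: "'a::finite profile"
  shows "(MAX i. dist (x i) y) = dist (opt_location x) y + (rightmost x - leftmost x) / 2"
proof -
  obtain j k where "leftmost x = x j" "rightmost x = x k"
    using leftmost_attained[of x] rightmost_attained[of x] by metis
  moreover have "(MAX i. dist (x i) y) = max (dist (leftmost x) y) (dist (rightmost x) y)"
  proof (rule Max_eqI)
    fix d
    assume "d \<in> range (\<lambda>i. dist (x i) y)"
    then obtain i where "d = dist (x i) y"
      by auto
    then show "d \<le> max (dist (leftmost x) y) (dist (rightmost x) y)"
      using leftmost_le[of x i] le_rightmost[of x i] by (auto simp: dist_real_def)
  qed (use calculation in \<open>auto simp: max_def\<close>)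
  ultimately show ?thesis
    using leftmost_le_rightmost[of x]
    by (auto simp: dist_real_def opt_location_eq max_def abs_if field_simps)
qed

text \<open>Either extreme costs \<open>2 * h\<close> and the midpoint costs the optimum
  \<open>h\<close>, so the prediction-free part averages \<open>3 / 2 * h\<close>; the clipped
  prediction costs \<open>h\<close> plus its distance to the midpoint.\<close>

lemma social_cost_mixture_mechanism:
  fixes x :: "'a::finite profile"
  assumes \<delta>: "0 \<le> \<delta>" "\<delta> \<le> 1 / 2"
  defines "h \<equiv> (rightmost x - leftmost x) / 2"
  shows "social_cost (mixture_mechanism \<delta> x F) x =
    ennreal ((1 + \<delta>) * h + (1 - 2 * \<delta>) * dist (opt_location x) (clip x F))"
proof -
  have h: "0 \<le> h" "dist (opt_location x) (leftmost x) = h" "dist (opt_location x) (rightmost x) = h"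
    using leftmost_le_rightmost[of x] by (auto simp: h_def opt_location_eq dist_real_def field_simps)
  show ?thesis
    unfolding social_cost_def Max_dist_eq h_def[symmetric]
    by (subst nn_integral_mixture_mechanism) (use \<delta> h in \<open>auto simp: algebra_simps\<close>)
qed

lemma social_cost_opt_location:
  "social_cost (return borel (opt_location x)) x = ennreal ((rightmost x - leftmost x) / 2)"
  unfolding social_cost_def Max_dist_eq by (subst nn_integral_return) auto

text \<open>Here \<open>t\<close> bounds the error of the clipped prediction in units of the optimal
  cost: \<open>t = 0\<close> gives consistency \<open>1 + \<delta>\<close>, and \<open>t = 1\<close>
  gives robustness \<open>2 - \<delta>\<close>.\<close>

lemma cost_ratio_mixture_mechanism_le:
  fixes x :: "'a::finite profile"
  assumes \<delta>: "0 \<le> \<delta>" "\<delta> \<le> 1 / 2"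
    and d: "dist (opt_location x) (clip x F) \<le> t * ((rightmost x - leftmost x) / 2)"
    and t: "0 \<le> t"
  shows "cost_ratio (mixture_mechanism \<delta> x F) x \<le> ennreal (1 + \<delta> + (1 - 2 * \<delta>) * t)"
proof -
  define h where "h = (rightmost x - leftmost x) / 2"
  have h: "0 \<le> h"
    using leftmost_le_rightmost[of x] by (simp add: h_def)
  have "(1 + \<delta>) * h + (1 - 2 * \<delta>) * dist (opt_location x) (clip x F)
      \<le> (1 + \<delta>) * h + (1 - 2 * \<delta>) * (t * h)"
    using d \<delta> by (intro add_left_mono mult_left_mono) (auto simp: h_def)
  also have "\<dots> = (1 + \<delta> + (1 - 2 * \<delta>) * t) * h"
    by (simp add: algebra_simps)
  finally have "social_cost (mixture_mechanism \<delta> x F) x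
      \<le> ennreal (1 + \<delta> + (1 - 2 * \<delta>) * t) * ennreal h"
    using h \<delta> t
    unfolding social_cost_mixture_mechanism[OF \<delta>, of x F, folded h_def]
    by (subst ennreal_mult[symmetric]) (auto intro!: ennreal_leI simp del: ennreal_plus)
  then show ?thesis
    unfolding cost_ratio_def social_cost_opt_location h_def[symmetric]
    \<comment> \<open>If \<open>h = 0\<close>, the mechanism has cost 0 too, and the ratio is
      \<open>0 / 0 = 0\<close> in \<open>ennreal\<close>.\<close>
    by (cases "h = 0") (use h in \<open>auto simp: divide_le_posI_ennreal mult.commute\<close>)
qed

lemma dist_clip_le: "dist (opt_location x) (clip x F) \<le> (rightmost x - leftmost x) / 2"
  using leftmost_le_rightmost[of x]
  by (auto simp: clip_def opt_location_eq dist_real_def max_def min_def abs_if field_simps)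

lemma clip_opt_location: "clip x (opt_location x) = opt_location x"
  using leftmost_le_rightmost[of x] by (simp add: clip_def opt_location_eq)

section \<open>Relabelling and rescaling\<close>

lemma lottery_relabel:
  assumes "bij \<pi>"
  shows "lottery \<delta> (x \<circ> \<pi>) F = lottery \<delta> x F"
proof -
  have "range (x \<circ> \<pi>) = range x"
    using bij_is_surj[OF assms] by (metis image_comp)
  then show ?thesis
    by (simp add: lottery_def clip_def leftmost_def rightmost_def opt_location_def)
qed

lemma extremes_scale_nonneg:
  assumes "0 \<le> c"
  shows "leftmost (\<lambda>i. c * x i) = c * leftmost x" "rightmost (\<lambda>i. c * x i) = c * rightmost x"
  by (metis assms leftmost_attained leftmost_eqI leftmost_le mult_left_mono)
    (metis assms rightmost_attained rightmost_eqI le_rightmost mult_left_mono)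

lemma extremes_scale_nonpos:
  assumes "c \<le> 0"
  shows "leftmost (\<lambda>i. c * x i) = c * rightmost x" "rightmost (\<lambda>i. c * x i) = c * leftmost x"
  by (metis assms rightmost_attained leftmost_eqI le_rightmost mult_left_mono_neg)
    (metis assms leftmost_attained rightmost_eqI leftmost_le mult_left_mono_neg)

lemma opt_location_scale: "opt_location (\<lambda>i. c * x i) = c * opt_location x"
  by (cases "0 \<le> c")
    (simp_all add: opt_location_eq extremes_scale_nonneg extremes_scale_nonpos algebra_simps)

lemma clip_scale: "clip (\<lambda>i. c * x i) (c * F) = c * clip x F"
proof (cases "0 \<le> c")
  case True
  then show ?thesis
    by (simp add: clip_def extremes_scale_nonneg max_mult_distrib_left min_mult_distrib_left)
next
  \<comment> \<open>A negative factor exchanges \<open>max\<close> with \<open>min\<close>; the two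
    orders of nesting agree because \<open>leftmost x \<le> rightmost x\<close>.\<close>
  case False
  then show ?thesis
    using leftmost_le_rightmost[of x]
    by (auto simp: clip_def extremes_scale_nonpos max_def min_def)
qed

text \<open>A negative factor swaps the two extreme agents, hence they have to be equally likely.\<close>

lemma lottery_scale: "lottery \<delta> (\<lambda>i. c * x i) (c * F) = map_pmf (\<lambda>y. c * y) (lottery \<delta> x F)"
  by (cases "0 \<le> c")
    (simp_all add: lottery_def map_mix_pmf clip_scale opt_location_scale
      extremes_scale_nonneg extremes_scale_nonpos
      mix_half_commute[of "return_pmf (c * rightmost x)"])

section \<open>Properties of the mechanism with a facility prediction\<close>

lemma randomized_mixture_mechanism: "randomized_mechanism (mixture_mechanism \<delta>)"
  unfolding randomized_mechanism_def mixture_mechanism_def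
  by (auto intro!: prob_space.prob_space_distr measure_pmf.prob_space_axioms)

lemma unanimous_mixture_mechanism: "unanimous (mixture_mechanism \<delta> :: ('a::finite, real) mechanism)"
  unfolding unanimous_def
proof (intro allI impI)
  fix x :: "'a profile" and F a
  assume "\<forall>i. x i = a"
  then have "leftmost x = a" "rightmost x = a"
    by (auto intro!: leftmost_eqI rightmost_eqI)
  then have "set_pmf (lottery \<delta> x F) \<subseteq> {a}"
    unfolding lottery_def clip_def opt_location_eq
    by (intro order_trans[OF set_mix_pmf_subset] Un_least) auto
  then show "AE y in mixture_mechanism \<delta> x F. y = a"
    unfolding mixture_mechanism_def by (subst AE_distr_iff) (auto simp: AE_measure_pmf_iff)
qed

lemma anonymous_mixture_mechanism: "anonymous facility_prediction (mixture_mechanism \<delta>)"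
  by (simp add: anonymous_def facility_prediction_def mixture_mechanism_def lottery_relabel)

lemma scale_independent_mixture_mechanism:
  "scale_independent facility_prediction (mixture_mechanism \<delta>)"
  by (simp add: scale_independent_def facility_prediction_def mixture_mechanism_def lottery_scale
      map_pmf_rep_eq distr_distr o_def)

lemma truthful_mixture_mechanism:
  assumes \<delta>: "0 \<le> \<delta>" "\<delta> \<le> 1 / 2"
  shows "truthful_in_expectation (mixture_mechanism \<delta> :: ('a::finite, real) mechanism)"
  unfolding truthful_in_expectation_def
proof (intro allI)
  fix x :: "'a profile" and F i x'
  let ?z = "x(i := x')"
  note facts = leftmost_le[of x i] le_rightmost[of x i] leftmost_upd_le[of x i x']
    rightmost_upd_ge[of x i x'] leftmost_le_rightmost[of ?z]
  \<comment> \<open>Each extreme moves away from \<open>x i\<close>, so the first two distances grow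
    in total by exactly the sum of the two displacements. The midpoint moves by at most half that
    sum, which its weight 2 just balances.\<close>
  have extremes: "dist (x i) (leftmost x) + dist (x i) (rightmost x) + 2 * dist (x i) (opt_location x)
      \<le> dist (x i) (leftmost ?z) + dist (x i) (rightmost ?z) + 2 * dist (x i) (opt_location ?z)"
    using facts unfolding opt_location_eq dist_real_def by argo
  \<comment> \<open>Say \<open>F \<ge> x i\<close>, so that the truthful outcome is
    \<open>min F (rightmost x)\<close>. Either this is \<open>x i\<close> itself, or
    \<open>x i < rightmost x\<close>; then the right end cannot move inwards, and the new outcome is
    at least as far to the right. The other side is symmetric.\<close>
  have clip: "dist (x i) (clip x F) \<le> dist (x i) (clip ?z F)"
    using facts unfolding clip_def dist_real_def by linarith
  show "agent_cost (x i) (mixture_mechanism \<delta> x F) \<le> agent_cost (x i) (mixture_mechanism \<delta> ?z F)"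
    unfolding agent_cost_def
    by (subst (1 2) nn_integral_mixture_mechanism)
      (use \<delta> extremes clip in \<open>auto intro!: ennreal_leI add_mono mult_left_mono\<close>)
qed

lemma consistent_mixture_mechanism:
  assumes \<delta>: "0 \<le> \<delta>" "\<delta> \<le> 1 / 2"
  shows "consistent facility_prediction (1 + \<delta>) (mixture_mechanism \<delta> :: ('a::finite, real) mechanism)"
proof -
  have "cost_ratio (mixture_mechanism \<delta> x (opt_location x)) x \<le> ennreal (1 + \<delta>)"
    for x :: "'a profile"
    using cost_ratio_mixture_mechanism_le[OF \<delta>, of x "opt_location x" 0]
    by (simp add: clip_opt_location)
  then show ?thesis
    by (auto simp: consistent_def facility_prediction_def intro!: SUP_least)
qed

lemma robust_mixture_mechanism:
  assumes \<delta>: "0 \<le> \<delta>" "\<delta> \<le> 1 / 2"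
  shows "robust (2 - \<delta>) (mixture_mechanism \<delta>)"
  using cost_ratio_mixture_mechanism_le[OF \<delta>, where t = 1] dist_clip_le
  by (auto simp: robust_def algebra_simps intro!: SUP_least)

theorem proposition1:
  fixes \<delta> :: real
  assumes "0 \<le> \<delta>" and "\<delta> \<le> 1 / 2"
  shows
    "(\<exists>f :: ('a::finite, real) mechanism.
        randomized_mechanism f \<and> unanimous f \<and>
        anonymous facility_prediction f \<and> scale_independent facility_prediction f \<and>
        truthful_in_expectation f \<and>
        consistent facility_prediction (1 + \<delta>) f \<and> robust (2 - \<delta>) f) \<and>
     (\<exists>f :: ('a::finite, 'a profile) mechanism.
        randomized_mechanism f \<and> unanimous f \<and>
        anonymous locations_prediction f \<and> scale_independent locations_prediction f \<and>
        truthful_in_expectation f \<and>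
        consistent locations_prediction (1 + \<delta>) f \<and> robust (2 - \<delta>) f)"
proof -
  let ?f = "mixture_mechanism \<delta> :: ('a, real) mechanism"
  let ?g = "\<lambda>x xh. ?f x (opt_location xh)"
  have f: "randomized_mechanism ?f" "unanimous ?f" "anonymous facility_prediction ?f"
    "scale_independent facility_prediction ?f" "truthful_in_expectation ?f"
    "consistent facility_prediction (1 + \<delta>) ?f" "robust (2 - \<delta>) ?f"
    using assms
    by (simp_all add: randomized_mixture_mechanism unanimous_mixture_mechanism
        anonymous_mixture_mechanism scale_independent_mixture_mechanism
        truthful_mixture_mechanism consistent_mixture_mechanism robust_mixture_mechanism)
  \<comment> \<open>\<open>opt_location\<close> sends an accurate, relabelled or rescaled location
    prediction to an accurate, unchanged or rescaled facility prediction. The other properties hold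
    for every facility prediction, in particular for \<open>opt_location xh\<close>, so
    \<open>?g\<close> inherits everything from \<open>?f\<close>.\<close>
  have relabel: "opt_location (xh \<circ> \<pi>) = opt_location xh" if "bij \<pi>" for xh :: "'a profile" and \<pi>
    using bij_is_surj[OF that] by (metis opt_location_def image_comp)
  have "randomized_mechanism ?g \<and> unanimous ?g \<and> anonymous locations_prediction ?g \<and>
      scale_independent locations_prediction ?g \<and> truthful_in_expectation ?g \<and>
      consistent locations_prediction (1 + \<delta>) ?g \<and> robust (2 - \<delta>) ?g"
  proof (intro conjI)
    show "anonymous locations_prediction ?g"
      using f(3)
      by (auto simp: anonymous_def facility_prediction_def locations_prediction_def relabel)
    show "scale_independent locations_prediction ?g"
      using f(4)
      by (simp add: scale_independent_def facility_prediction_def locations_prediction_def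
          opt_location_scale)
    show "truthful_in_expectation ?g"
      using f(5) unfolding truthful_in_expectation_def by blast
    show "consistent locations_prediction (1 + \<delta>) ?g"
      using f(6)
      by (auto simp: consistent_def facility_prediction_def locations_prediction_def SUP_le_iff)
    show "randomized_mechanism ?g"
      using f(1) unfolding randomized_mechanism_def by blast
    show "unanimous ?g"
      using f(2) unfolding unanimous_def by blast
    show "robust (2 - \<delta>) ?g"
      using f(7) by (auto simp: robust_def SUP_le_iff)
  qed
  with f show ?thesis
    by blast
qed

end
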